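(* Let $n\ge1$ be an integer. (a) The symmetric group $\mathcal{S}_n$ acting on $\{1,\dots,n\}$ is fixating if and only if $n\le4$. (b) The alternating group $\mathcal{A}_n$ of even permutations acting on $\{1,\dots,n\}$ is fixating if and only if $n\le4$.
   Context: For a bijection $g$ of a set $X$, $\mathrm{Fix}\,g=\{x\in X: g(x)=x\}$. A group $H$ of bijections of $X$ is a GAF if $\mathrm{Fix}\,g\neq\emptyset$ for every $g\in H$; it is a GAG if $\bigcap_{g\in H}\mathrm{Fix}\,g\ne\emptyset$. A group $G$ of bijections of $X$ is fixating if every subgroup of $G$ that is a GAF is a GAG. *)

theory Defs
  imports "HOL-Algebra.Sym_Groups"
begin

text \<open>
  Groups of bijections of a set \<open>X\<close> are monoid records whose elements are functions that restrict to
  bijections of \<open>X\<close>, multiplied by composition. Elements of \<^const>\<open>sym_group\<close> and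
  \<^const>\<open>alt_group\<close> act on \<open>{1..n}\<close> and are the identity on all other natural numbers, so fixed
  points have to be taken relative to \<open>X\<close>.
\<close>

definition Fix :: "'a set \<Rightarrow> ('a \<Rightarrow> 'a) \<Rightarrow> 'a set"
  where "Fix X g = {x \<in> X. g x = x}"

definition GAF :: "'a set \<Rightarrow> ('a \<Rightarrow> 'a) set \<Rightarrow> bool"
  where "GAF X H \<longleftrightarrow> (\<forall>g \<in> H. Fix X g \<noteq> {})"

definition GAG :: "'a set \<Rightarrow> ('a \<Rightarrow> 'a) set \<Rightarrow> bool"
  where "GAG X H \<longleftrightarrow> (\<Inter>g \<in> H. Fix X g) \<noteq> {}"

definition fixating :: "'a set \<Rightarrow> ('a \<Rightarrow> 'a) monoid \<Rightarrow> bool"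
  where "fixating X G \<longleftrightarrow> (\<forall>H. subgroup H G \<longrightarrow> GAF X H \<longrightarrow> GAG X H)"

end

theory Submission
  imports Defs "HOL-Algebra.Group_Action" "HOL-Algebra.Multiplicative_Group"
begin

text \<open>
  For \<open>n \<le> 4\<close>, let \<open>H\<close> be a group of permutations of \<open>{1..n}\<close> without a common fixed point, so that no orbit
  is a singleton. If \<open>H\<close> is transitive then Burnside's lemma says that its elements have one fixed point on
  average; as the identity has \<open>n > 1\<close> of them, some element has none (Jordan's theorem,
  \<open>transitive_has_derangement\<close>). The only other possibility is \<open>n = 4\<close> with two orbits of size two. Take
  \<open>a\<close> swapping the first orbit and \<open>b\<close> swapping the second: one of \<open>a\<close>, \<open>b\<close>, \<open>a \<circ> b\<close> swaps both. So \<open>H\<close> is not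
  a GAF. Being fixating is inherited by subgroups, in particular by the alternating group.

  For \<open>n \<ge> 5\<close> it is therefore enough to find, inside the alternating group, a GAF that is not a GAG. The
  device is parity (\<open>not_fixating_alt_group_if_derangements_odd\<close>): if all fixed-point-free permutations
  that preserve some structure on \<open>{1..n}\<close> are odd, then the even permutations preserving it form a GAF.
  Suitable structures are

  \<^item> for \<open>n = 5\<close>, the partition \<open>123|45\<close>: a fixed-point-free permutation preserving it is a 3-cycle times a
    transposition;

  \<^item> for \<open>n = 6\<close>, the partition \<open>12|34|56\<close> with labelled blocks: the only fixed-point-free permutation
    preserving it is a product of three transpositions;

  \<^item> for \<open>n = 7\<close>, the partition \<open>12345|67\<close> together with the affine structure of the integers modulo 5 on the
    first block: a fixed-point-free affine map modulo 5 is a translation, so a fixed-point-free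
    permutation preserving the structure is a 5-cycle times a transposition.

  A witness for \<open>m\<close> gives one for every \<open>n \<ge> m + 3\<close>, by multiplying it with the alternating group on the
  remaining points (\<open>not_fixating_alt_group_extend\<close>): at least three new points are needed for that group to
  move each of them. Starting from \<open>m = 5\<close> this settles all \<open>n \<ge> 8\<close>.
\<close>

(* Keeps the interval {1..n} from being rewritten to {Suc 0..n}. *)
declare One_nat_def [simp del]

section \<open>Jordan's theorem\<close>

text \<open>
  By Burnside's lemma the number of pairs \<open>(h, x)\<close> with \<open>h x = x\<close> is \<open>card H\<close>. If every \<open>h\<close> had a fixed
  point, each would have to have exactly one, but the identity has \<open>n\<close>.
\<close>

lemma transitive_has_derangement:
  assumes H: "subgroup H (sym_group n)" and n: "n \<ge> 2"
    and trans: "\<And>x y. x \<in> {1..n} \<Longrightarrow> y \<in> {1..n} \<Longrightarrow> \<exists>h\<in>H. h x = y"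
  shows "\<exists>h\<in>H. Fix {1..n} h = {}"
proof (rule ccontr)
  assume contr: "\<not> ?thesis"
  define G where "G = (sym_group n)\<lparr>carrier := H\<rparr>"
  define \<phi> :: "(nat \<Rightarrow> nat) \<Rightarrow> nat \<Rightarrow> nat" where "\<phi> = (\<lambda>p. restrict p {1..n})"
  have HS: "p permutes {1..n}" if "p \<in> H" for p
    using subgroup.subset[OF H] that by (auto simp: sym_group_carrier)
  have G: "carrier G = H" "mult G = (\<circ>)"
    by (simp_all add: G_def sym_group_mult)
  have fin: "finite H"
    by (rule finite_subset[OF _ finite_permutations[of "{1..n}"]]) (use HS in auto)
  have idH: "id \<in> H"
    using subgroup.one_closed[OF H] by (simp add: sym_group_one)
  \<comment> \<open>Restriction to \<open>{1..n}\<close> makes the permutations extensional, as the elements of \<^const>\<open>BijGroup\<close> are.\<close>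
  have Bij: "\<phi> p \<in> Bij {1..n}" if "p \<in> H" for p
    using permutes_imp_bij[OF HS[OF that]] by (simp add: \<phi>_def Bij_def)
  have hom: "\<phi> \<in> hom G (BijGroup {1..n})"
  proof (rule homI)
    fix p q assume pq: "p \<in> carrier G" "q \<in> carrier G"
    have "\<phi> (p \<circ> q) = compose {1..n} (\<phi> p) (\<phi> q)"
      using permutes_in_image[OF HS, of q] pq by (auto simp: fun_eq_iff compose_def \<phi>_def G restrict_def)
    then show "\<phi> (p \<otimes>\<^bsub>G\<^esub> q) = \<phi> p \<otimes>\<^bsub>BijGroup {1..n}\<^esub> \<phi> q"
      using pq Bij by (simp add: G BijGroup_def)
  qed (use Bij in \<open>auto simp: G BijGroup_def\<close>)
  interpret group_action G "{1..n}" \<phi>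
    unfolding group_action_def group_hom_def group_hom_axioms_def
    using hom group.subgroup_imp_group[OF sym_group_is_group H] group_BijGroup
    by (auto simp: G_def)
  have orb: "orbit G \<phi> x = {1..n}" if "x \<in> {1..n}" for x
  proof -
    have "h x \<in> {1..n}" if "h \<in> H" for h
      using permutes_in_image[OF HS[OF that]] \<open>x \<in> {1..n}\<close> by blast
    moreover have "y \<in> (\<lambda>h. h x) ` H" if "y \<in> {1..n}" for y
      using trans[OF \<open>x \<in> {1..n}\<close> that] by blast
    ultimately have "(\<lambda>h. h x) ` H = {1..n}" by blast
    then show ?thesis
      using that by (auto simp: orbit_def G \<phi>_def)
  qed
  have "1 \<in> {1..n}" using n by simp
  then have "orbits G {1..n} \<phi> = {{1..n}}"
    unfolding orbits_def using orb by blast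
  then have "card H = (\<Sum>g\<in>H. card (invariants {1..n} \<phi> g))"
    using burnside fin by (simp add: G order_def)
  also have "\<dots> = (\<Sum>g\<in>H. card (Fix {1..n} g))"
    by (intro sum.cong refl arg_cong[where f = card]) (auto simp: invariants_def Fix_def \<phi>_def)
  also have "\<dots> > (\<Sum>g\<in>H. 1)"
  proof (rule sum_strict_mono_ex1[OF fin])
    show "\<forall>h\<in>H. 1 \<le> card (Fix {1..n} h)"
    proof
      fix h assume "h \<in> H"
      then have "Fix {1..n} h \<noteq> {}" using contr by blast
      moreover have "finite (Fix {1..n} h)" by (simp add: Fix_def)
      ultimately have "card (Fix {1..n} h) \<noteq> 0" by simp
      then show "1 \<le> card (Fix {1..n} h)" by simp
    qed
    show "\<exists>h\<in>H. 1 < card (Fix {1..n} h)"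
    proof (rule bexI[OF _ idH])
      have "Fix {1..n} id = {1..n}" by (auto simp: Fix_def)
      then show "1 < card (Fix {1..n} id)" using n by simp
    qed
  qed
  finally show False by simp
qed

section \<open>At most four points\<close>

text \<open>
  The two non-trivial orbits below are \<open>{1, a 1}\<close> and \<open>{u, b u}\<close>; as there are at most four points, they
  cover everything.
\<close>

lemma fixating_sym_group:
  assumes "n \<le> 4"
  shows "fixating {1..n} (sym_group n)"
  unfolding fixating_def
proof (intro allI impI)
  fix H assume H: "subgroup H (sym_group n)" and gaf: "GAF {1..n} H"
  have perm: "p permutes {1..n}" if "p \<in> H" for p
    using subgroup.subset[OF H] that by (auto simp: sym_group_carrier)
  have comp: "p \<circ> q \<in> H" if "p \<in> H" "q \<in> H" for p q
    using subgroup.m_closed[OF H that] by (simp add: sym_group_mult)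
  have inv: "inv' p \<in> H" if "p \<in> H" for p
    using subgroup.m_inv_closed[OF H that] sym_group_inv_equality subgroup.subset[OF H] that by auto
  have idH: "id \<in> H"
    using subgroup.one_closed[OF H] by (simp add: sym_group_one)
  have inX: "p x \<in> {1..n} \<longleftrightarrow> x \<in> {1..n}" if "p \<in> H" for p x
    using permutes_in_image[OF perm[OF that]] .
  have inj: "p x = p y \<longleftrightarrow> x = y" if "p \<in> H" for p x y
    using permutes_inj[OF perm[OF that]] by (auto dest: injD)
  have fix_ex: "\<exists>x\<in>{1..n}. p x = x" if "p \<in> H" for p
    using gaf that unfolding GAF_def Fix_def by blast
  show "GAG {1..n} H"
  proof (rule ccontr)
    assume "\<not> GAG {1..n} H"
    then have moved: "\<exists>p\<in>H. p x \<noteq> x" if "x \<in> {1..n}" for x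
      using that unfolding GAG_def Fix_def by blast
    have "{1..n} \<noteq> {}" using fix_ex[OF idH] by auto
    then have one: "1 \<in> {1..n}" by simp
    obtain a where a: "a \<in> H" "a 1 \<noteq> 1" using moved[OF one] by blast
    have "n \<ge> 2" using a inX[OF a(1), of 1] one by auto
    then obtain u v where uv: "u \<in> {1..n}" "v \<in> {1..n}" "\<forall>h\<in>H. h u \<noteq> v"
      using transitive_has_derangement[OF H] fix_ex by (fastforce simp: Fix_def)
    \<comment> \<open>Otherwise the orbit of 1 would contain \<open>u\<close> and \<open>v\<close>, hence \<open>u\<close> could be sent to \<open>v\<close> by way of 1.\<close>
    have "\<exists>u\<in>{1..n}. \<forall>h\<in>H. h 1 \<noteq> u"
    proof (rule ccontr)
      assume "\<not> ?thesis"
      then obtain g h where "g \<in> H" "g 1 = u" "h \<in> H" "h 1 = v" using uv by blast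
      moreover from this have "inv' g u = 1" using permutes_inverses(2)[OF perm] by blast
      ultimately show False using uv(3) comp[OF \<open>h \<in> H\<close> inv[OF \<open>g \<in> H\<close>]] by auto
    qed
    then obtain u where u: "u \<in> {1..n}" and u_orb: "\<And>h. h \<in> H \<Longrightarrow> h 1 \<noteq> u" by blast
    obtain b where b: "b \<in> H" "b u \<noteq> u" using moved[OF u] by blast
    have bu_orb: "h 1 \<noteq> b u" if "h \<in> H" for h
    proof
      assume "h 1 = b u"
      then have "(inv' b \<circ> h) 1 = u" using permutes_inverses(2)[OF perm[OF b(1)]] by simp
      then show False using u_orb comp[OF inv[OF b(1)] that] by blast
    qed
    have sub: "{1, a 1, u, b u} \<subseteq> {1..n}"
      using one u inX[OF a(1)] inX[OF b(1)] by simp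
    have card4: "card {1, a 1, u, b u} = 4"
      using a b u_orb[OF idH] u_orb[OF a(1)] bu_orb[OF idH] bu_orb[OF a(1)] by (auto simp: card_insert_if)
    have X: "{1..n} = {1, a 1, u, b u}"
      using card_seteq[OF _ sub] card4 assms by simp
    have P: "p 1 = 1 \<and> p (a 1) = a 1 \<or> p 1 = a 1 \<and> p (a 1) = 1" if "p \<in> H" for p
    proof -
      have "p 1 \<in> {1, a 1}"
        using inX[OF that, of 1] one u_orb[OF that] bu_orb[OF that] unfolding X by auto
      moreover have "p (a 1) \<in> {1, a 1}"
        using inX[OF that, of "a 1"] u_orb[OF comp[OF that a(1)]] bu_orb[OF comp[OF that a(1)]]
        unfolding X by auto
      ultimately show ?thesis using inj[OF that, of 1 "a 1"] a(2) by auto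
    qed
    have Q: "p u = u \<and> p (b u) = b u \<or> p u = b u \<and> p (b u) = u" if "p \<in> H" for p
    proof -
      have "p u \<in> {1..n}" "p (b u) \<in> {1..n}" using inX[OF that] sub by auto
      then show ?thesis
        unfolding X using P[OF that] inj[OF that] u_orb bu_orb idH a(1) b(2)
        by (metis (no_types, lifting) insertE empty_iff id_apply)
    qed
    \<comment> \<open>The derangement is \<open>a\<close>, \<open>b\<close> or \<open>a \<circ> b\<close>, respectively.\<close>
    consider "a u \<noteq> u" | "b 1 \<noteq> 1" | "a u = u" "b 1 = 1" by blast
    then show False
    proof cases
      case 1 then show False using fix_ex[OF a(1)] P[OF a(1)] Q[OF a(1)] a b unfolding X by auto
    next
      case 2 then show False using fix_ex[OF b(1)] P[OF b(1)] Q[OF b(1)] a b unfolding X by auto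
    next
      case 3 then show False
        using fix_ex[OF comp[OF a(1) b(1)]] P[OF a(1)] Q[OF a(1)] P[OF b(1)] Q[OF b(1)] a b
        unfolding X by auto
    qed
  qed
qed

lemma fixating_subgroup:
  assumes "group G" "subgroup K G" "fixating X G"
  shows "fixating X (G\<lparr>carrier := K\<rparr>)"
  using assms group.incl_subgroup unfolding fixating_def by blast

section \<open>Subgroups of the alternating group that are GAFs but not GAGs\<close>

text \<open>In a finite group \<open>x [^] (order G - 1)\<close> is the inverse of \<open>x\<close>, so inverses come for free.\<close>

lemma (in group) finite_closed_subgroup:
  assumes fin: "finite (carrier G)" and H: "H \<subseteq> carrier G" "\<one> \<in> H"
    and closed: "\<And>x y. x \<in> H \<Longrightarrow> y \<in> H \<Longrightarrow> x \<otimes> y \<in> H"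
  shows "subgroup H G"
proof -
  have pow: "x [^] (k::nat) \<in> H" if "x \<in> H" for x k
    by (induction k) (use that H closed in auto)
  have "inv x \<in> H" if x: "x \<in> H" for x
  proof -
    have xG: "x \<in> carrier G" using x H by blast
    have "order G > 0" using fin order_gt_0_iff_finite by blast
    then have "x [^] (order G - 1) \<otimes> x = \<one>"
      using pow_order_eq_1[OF xG] nat_pow_Suc[of x "order G - 1"] by simp
    then have "inv x = x [^] (order G - 1)" using inv_equality xG by simp
    then show ?thesis using pow[OF x] by simp
  qed
  then show ?thesis using H closed by (auto intro!: subgroupI)
qed

lemma not_fixating_alt_groupI:
  assumes H: "\<And>p. p \<in> H \<Longrightarrow> p permutes {1..n}" "\<And>p. p \<in> H \<Longrightarrow> evenperm p" "id \<in> H"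
    and closed: "\<And>p q. p \<in> H \<Longrightarrow> q \<in> H \<Longrightarrow> p \<circ> q \<in> H"
    and fixed: "\<And>p. p \<in> H \<Longrightarrow> \<exists>x\<in>{1..n}. p x = x"
    and moved: "\<And>x. x \<in> {1..n} \<Longrightarrow> \<exists>p\<in>H. p x \<noteq> x"
  shows "\<not> fixating {1..n} (alt_group n)"
proof -
  have "finite (carrier (alt_group n))"
    by (rule finite_subset[OF _ finite_permutations[of "{1..n}"]]) (auto simp: alt_group_carrier)
  then have "subgroup H (alt_group n)"
    by (intro group.finite_closed_subgroup alt_group_is_group)
       (use H closed in \<open>auto simp: alt_group_carrier alt_group_mult alt_group_one\<close>)
  moreover have "GAF {1..n} H" using fixed unfolding GAF_def Fix_def by blast
  moreover have "\<not> GAG {1..n} H" using moved H(3) unfolding GAG_def Fix_def by blast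
  ultimately show ?thesis unfolding fixating_def by blast
qed

lemma evenperm_comp_permutes:
  assumes "finite S" "p permutes S" "q permutes S"
  shows "evenperm (p \<circ> q) \<longleftrightarrow> evenperm p = evenperm q"
  using assms by (intro evenperm_comp permutes_imp_permutation)

text \<open>
  The witness consists of the even permutations that satisfy \<open>S\<close>: discarding the odd ones discards all
  derangements.
\<close>

lemma not_fixating_alt_group_if_derangements_odd:
  assumes S_id: "S id"
    and S_comp: "\<And>p q. p permutes {1..n} \<Longrightarrow> q permutes {1..n} \<Longrightarrow> S p \<Longrightarrow> S q \<Longrightarrow> S (p \<circ> q)"
    and odd: "\<And>p. p permutes {1..n} \<Longrightarrow> S p \<Longrightarrow> (\<And>x. x \<in> {1..n} \<Longrightarrow> p x \<noteq> x) \<Longrightarrow> \<not> evenperm p"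
    and moved: "\<And>x. x \<in> {1..n} \<Longrightarrow> \<exists>p. p permutes {1..n} \<and> evenperm p \<and> S p \<and> p x \<noteq> x"
  shows "\<not> fixating {1..n} (alt_group n)"
proof (rule not_fixating_alt_groupI[where H = "{p. p permutes {1..n} \<and> evenperm p \<and> S p}"])
  fix p q
  assume "p \<in> {p. p permutes {1..n} \<and> evenperm p \<and> S p}" "q \<in> {p. p permutes {1..n} \<and> evenperm p \<and> S p}"
  then show "p \<circ> q \<in> {p. p permutes {1..n} \<and> evenperm p \<and> S p}"
    using S_comp evenperm_comp_permutes[of "{1..n}" p q] permutes_compose[of q "{1..n}" p] by blast
next
  fix p assume "p \<in> {p. p permutes {1..n} \<and> evenperm p \<and> S p}"
  then show "\<exists>x\<in>{1..n}. p x = x" using odd[of p] by blast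
next
  fix x assume "x \<in> {1..n}"
  then show "\<exists>p\<in>{p. p permutes {1..n} \<and> evenperm p \<and> S p}. p x \<noteq> x" using moved by blast
qed (use S_id in auto)

lemma permutes_disjoint_commute:
  assumes "p permutes A" "q permutes B" "A \<inter> B = {}"
  shows "p \<circ> q = q \<circ> p"
proof
  fix x
  have "p x \<notin> B" if "x \<in> A" using permutes_in_image[OF assms(1)] assms(3) that by blast
  moreover have "q x \<notin> A" if "x \<in> B" using permutes_in_image[OF assms(2)] assms(3) that by blast
  moreover have "x \<notin> A \<or> x \<notin> B" using assms(3) by blast
  ultimately show "(p \<circ> q) x = (q \<circ> p) x"
    using permutes_not_in[OF assms(1)] permutes_not_in[OF assms(2)]
    by (cases "x \<in> A"; cases "x \<in> B") simp_all
qed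

text \<open>
  The product of a witness \<open>K\<close> on \<open>{1..m}\<close> with the alternating group \<open>L\<close> on the remaining points: a fixed
  point in \<open>{1..m}\<close> of the first factor is not moved by the second, and on three or more points every
  point is moved by a 3-cycle.
\<close>

lemma not_fixating_alt_group_extend:
  assumes m: "\<not> fixating {1..m} (alt_group m)" and mn: "m + 3 \<le> n"
  shows "\<not> fixating {1..n} (alt_group n)"
proof -
  obtain K where K: "subgroup K (alt_group m)" and gaf: "GAF {1..m} K" and gag: "\<not> GAG {1..m} K"
    using m by (auto simp: fixating_def)
  define B where "B = {m<..n}"
  define L where "L = {q. q permutes B \<and> evenperm q}"
  have K_perm: "p permutes {1..m}" "evenperm p" if "p \<in> K" for p
    using subgroup.subset[OF K] that by (auto simp: alt_group_carrier)
  have K_comp: "p \<circ> p' \<in> K" if "p \<in> K" "p' \<in> K" for p p'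
    using subgroup.m_closed[OF K that] by (simp add: alt_group_mult)
  have K_id: "id \<in> K"
    using subgroup.one_closed[OF K] by (simp add: alt_group_one)
  have L_id: "id \<in> L" by (simp add: L_def)
  have fin: "finite B" "finite {1..m}" and disj: "{1..m} \<inter> B = {}" by (auto simp: B_def)
  have L_comp: "q \<circ> q' \<in> L" if "q \<in> L" "q' \<in> L" for q q'
    using that fin by (auto simp: L_def permutes_compose evenperm_comp permutes_imp_permutation)
  have KL: "(p \<circ> q) permutes {1..n}" "evenperm (p \<circ> q)" if "p \<in> K" "q \<in> L" for p q
  proof -
    have "p permutes {1..n}"
      by (rule permutes_subset[OF K_perm(1)[OF that(1)]]) (use mn in auto)
    moreover have "q permutes {1..n}"
      by (rule permutes_subset[of q B]) (use that(2) in \<open>auto simp: L_def B_def\<close>)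
    ultimately show "(p \<circ> q) permutes {1..n}" by (rule permutes_compose[rotated])
    show "evenperm (p \<circ> q)"
      using evenperm_comp[of p q] permutes_imp_permutation[OF fin(2) K_perm(1)]
        permutes_imp_permutation[OF fin(1)] K_perm(2) that by (auto simp: L_def)
  qed
  show ?thesis
  proof (rule not_fixating_alt_groupI[where H = "{p \<circ> q |p q. p \<in> K \<and> q \<in> L}"])
    fix r s assume "r \<in> {p \<circ> q |p q. p \<in> K \<and> q \<in> L}" "s \<in> {p \<circ> q |p q. p \<in> K \<and> q \<in> L}"
    then obtain p q p' q' where *: "r = p \<circ> q" "s = p' \<circ> q'" "p \<in> K" "q \<in> L" "p' \<in> K" "q' \<in> L"
      by blast
    have "q \<circ> p' = p' \<circ> q"
      using permutes_disjoint_commute[OF K_perm(1) _ disj, of p' q] * by (simp add: L_def)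
    then have "r \<circ> s = (p \<circ> p') \<circ> (q \<circ> q')"
      unfolding * by (metis comp_assoc)
    then show "r \<circ> s \<in> {p \<circ> q |p q. p \<in> K \<and> q \<in> L}"
      using K_comp L_comp * by blast
  next
    fix r assume "r \<in> {p \<circ> q |p q. p \<in> K \<and> q \<in> L}"
    then obtain p q where *: "r = p \<circ> q" "p \<in> K" "q \<in> L" by blast
    obtain x where x: "x \<in> {1..m}" "p x = x"
      using gaf \<open>p \<in> K\<close> unfolding GAF_def Fix_def by blast
    have "q x = x" using * x disj by (auto simp: L_def intro!: permutes_not_in)
    then show "\<exists>x\<in>{1..n}. r x = x" using x * mn by (intro bexI[of _ x]) auto
  next
    fix x assume x: "x \<in> {1..n}"
    show "\<exists>r\<in>{p \<circ> q |p q. p \<in> K \<and> q \<in> L}. r x \<noteq> x"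
    proof (cases "x \<le> m")
      case True
      then obtain p where "p \<in> K" "p x \<noteq> x"
        using gag x K_id unfolding GAG_def Fix_def by fastforce
      moreover have "p = p \<circ> id" by simp
      ultimately show ?thesis using L_id by blast
    next
      case False
      have "card (B - {x}) \<ge> 2" using mn False x by (simp add: B_def)
      then obtain y z where yz: "y \<in> B" "z \<in> B" "y \<noteq> x" "z \<noteq> x" "y \<noteq> z"
        by (auto simp: card_le_Suc_iff numeral_2_eq_2)
      have xB: "x \<in> B" using x False by (simp add: B_def)
      define q where "q = transpose x y \<circ> transpose y z"
      have "q \<in> L"
        using yz xB by (auto simp: L_def q_def evenperm_comp evenperm_swap permutation_swap_id
            intro!: permutes_compose permutes_swap_id)
      moreover have "q x \<noteq> x" using yz by (simp add: q_def)
      moreover have "q = id \<circ> q" by simp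
      ultimately show ?thesis using K_id by blast
    qed
  qed (use KL in auto, metis K_id L_id comp_id)
qed

section \<open>Five, six and seven points\<close>

text \<open>
  A derangement preserving \<open>{4, 5}\<close> swaps these points and acts as a 3-cycle on the others, so its cube
  is a transposition. An odd cube has an odd root.
\<close>

lemma not_fixating_alt_group_5: "\<not> fixating {1..5} (alt_group 5)"
proof (rule not_fixating_alt_group_if_derangements_odd[where S = "\<lambda>p. p ` {4,5} = {4,5}"])
  fix p :: "nat \<Rightarrow> nat"
  assume p: "p permutes {1..5}" "p ` {4,5} = {4,5}"
    and no_fix: "\<And>x. x \<in> {1..5} \<Longrightarrow> p x \<noteq> x"
  have inj: "p x = p y \<longleftrightarrow> x = y" for x y
    using permutes_inj[OF p(1)] by (auto dest: injD)
  have p45: "p 4 = 5" "p 5 = 4" using p(2) no_fix[of 4] no_fix[of 5] by (simp_all add: doubleton_eq_iff)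
  have p123: "p x \<in> {1,2,3}" if "x \<in> {1,2,3}" for x
  proof -
    have "p x \<in> {1..5}" using permutes_in_image[OF p(1), of x] that by auto
    moreover have "p x \<noteq> 4" "p x \<noteq> 5" using that inj[of x 5] inj[of x 4] p45 by auto
    ultimately show ?thesis by force
  qed
  have "p \<circ> p \<circ> p = transpose 4 5"
  proof
    fix x :: nat
    consider "x \<in> {1,2,3}" | "x = 4" | "x = 5" | "x \<notin> {1..5}" by fastforce
    then show "(p \<circ> p \<circ> p) x = transpose 4 5 x"
    proof cases
      case 1
      then show ?thesis
        using p123[of 1] p123[of 2] p123[of 3] no_fix[of 1] no_fix[of 2] no_fix[of 3]
          inj[of 1 2] inj[of 1 3] inj[of 2 3] by auto
    qed (use p45 permutes_not_in[OF p(1)] in auto)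
  qed
  then have "\<not> evenperm (p \<circ> p \<circ> p)" by (simp add: evenperm_swap)
  then show "\<not> evenperm p"
    using p(1) by (simp add: evenperm_comp_permutes[of "{1..5}"] permutes_compose del: o_apply)
next
  fix x :: nat assume x: "x \<in> {1..5}"
  show "\<exists>p. p permutes {1..5} \<and> evenperm p \<and> p ` {4,5} = {4,5} \<and> p x \<noteq> x"
  proof (cases "x \<le> 3")
    case True
    then show ?thesis using x
      by (intro exI[of _ "transpose 1 2 \<circ> transpose 2 3"])
         (auto simp: transpose_def evenperm_comp evenperm_swap permutation_swap_id
           intro!: permutes_compose permutes_swap_id)
  next
    case False
    then show ?thesis using x
      by (intro exI[of _ "transpose 1 2 \<circ> transpose 4 5"])
         (auto simp: transpose_def evenperm_comp evenperm_swap permutation_swap_id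
           intro!: permutes_compose permutes_swap_id)
  qed
next
  fix p q :: "nat \<Rightarrow> nat"
  assume "p ` {4,5} = {4,5}" "q ` {4,5} = {4,5}"
  then show "(p \<circ> q) ` {4,5} = {4,5}" by (simp only: image_comp [symmetric])
qed simp

lemma not_fixating_alt_group_6: "\<not> fixating {1..6} (alt_group 6)"
proof (rule not_fixating_alt_group_if_derangements_odd
    [where S = "\<lambda>p. p ` {1,2} = {1,2} \<and> p ` {3,4} = {3,4} \<and> p ` {5,6} = {5,6}"])
  fix p :: "nat \<Rightarrow> nat"
  assume p: "p permutes {1..6}" "p ` {1,2} = {1,2} \<and> p ` {3,4} = {3,4} \<and> p ` {5,6} = {5,6}"
    and no_fix: "\<And>x. x \<in> {1..6} \<Longrightarrow> p x \<noteq> x"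
  have vals: "p 1 = 2" "p 2 = 1" "p 3 = 4" "p 4 = 3" "p 5 = 6" "p 6 = 5"
    using p(2) no_fix[of 1] no_fix[of 2] no_fix[of 3] no_fix[of 4] no_fix[of 5] no_fix[of 6]
    by (simp_all add: doubleton_eq_iff)
  have "p = transpose 1 2 \<circ> transpose 3 4 \<circ> transpose 5 6"
  proof
    fix x :: nat
    consider "x = 1" | "x = 2" | "x = 3" | "x = 4" | "x = 5" | "x = 6" | "x \<notin> {1..6}" by fastforce
    then show "p x = (transpose 1 2 \<circ> transpose 3 4 \<circ> transpose 5 6) x"
      by cases (use vals permutes_not_in[OF p(1)] in \<open>auto simp: transpose_def\<close>)
  qed
  then show "\<not> evenperm p"
    by (simp add: evenperm_comp evenperm_swap permutation_swap_id permutation_compose del: o_apply)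
next
  fix x :: nat assume x: "x \<in> {1..6}"
  show "\<exists>p. p permutes {1..6} \<and> evenperm p \<and>
    (p ` {1,2} = {1,2} \<and> p ` {3,4} = {3,4} \<and> p ` {5,6} = {5,6}) \<and> p x \<noteq> x"
  proof (cases "x \<le> 4")
    case True
    then show ?thesis using x
      by (intro exI[of _ "transpose 1 2 \<circ> transpose 3 4"])
         (auto simp: transpose_def evenperm_comp evenperm_swap permutation_swap_id
           intro!: permutes_compose permutes_swap_id)
  next
    case False
    then show ?thesis using x
      by (intro exI[of _ "transpose 1 2 \<circ> transpose 5 6"])
         (auto simp: transpose_def evenperm_comp evenperm_swap permutation_swap_id
           intro!: permutes_compose permutes_swap_id)
  qed
next
  fix p q :: "nat \<Rightarrow> nat"
  assume "p ` {1,2} = {1,2} \<and> p ` {3,4} = {3,4} \<and> p ` {5,6} = {5,6}"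
    "q ` {1,2} = {1,2} \<and> q ` {3,4} = {3,4} \<and> q ` {5,6} = {5,6}"
  then show "(p \<circ> q) ` {1,2} = {1,2} \<and> (p \<circ> q) ` {3,4} = {3,4} \<and> (p \<circ> q) ` {5,6} = {5,6}"
    by (simp only: image_comp [symmetric])
qed simp

text \<open>
  The points 1 to 5 stand for the residue classes modulo 5, with 5 in the role of 0.
\<close>

definition affine_mod5 :: "(nat \<Rightarrow> nat) \<Rightarrow> bool"
  where "affine_mod5 p \<longleftrightarrow> (\<exists>a b. \<forall>x\<in>{1..5}. p x mod 5 = (a * x + b) mod 5)"

text \<open>
  A derangement \<open>x \<mapsto> a * x + b\<close> modulo 5 has \<open>a = 1\<close>, because otherwise \<open>(a - 1) * x = - b\<close> is solvable. So
  the fifth power of a derangement in the group is the transposition of 6 and 7, which is odd.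
\<close>

lemma not_fixating_alt_group_7: "\<not> fixating {1..7} (alt_group 7)"
proof (rule not_fixating_alt_group_if_derangements_odd
    [where S = "\<lambda>p. p ` {6,7} = {6,7} \<and> affine_mod5 p"])
  fix p :: "nat \<Rightarrow> nat"
  assume p: "p permutes {1..7}"
    and S: "p ` {6,7} = {6,7} \<and> affine_mod5 p"
    and no_fix: "\<And>x. x \<in> {1..7} \<Longrightarrow> p x \<noteq> x"
  obtain a b where ab: "\<And>x. x \<in> {1..5} \<Longrightarrow> p x mod 5 = (a * x + b) mod 5"
    using S unfolding affine_mod5_def by blast
  have p67: "p 6 = 7" "p 7 = 6" using conjunct1[OF S] no_fix[of 6] no_fix[of 7] by (simp_all add: doubleton_eq_iff)
  have range: "p x \<in> {1..5}" if "x \<in> {1..5}" for x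
  proof -
    have "p x \<in> {1..7}" using permutes_in_image[OF p, of x] that by auto
    moreover have "p x \<noteq> p 6" "p x \<noteq> p 7" using that injD[OF permutes_inj[OF p]] by fastforce+
    ultimately show ?thesis using p67 by force
  qed
  have eq: "x = y" if "x mod 5 = y mod 5" "x \<in> {1..5}" "y \<in> {1..5}" for x y :: nat
  proof -
    have "x \<in> {1,2,3,4,5}" "y \<in> {1,2,3,4,5}" using that by auto
    then show ?thesis using that(1) by auto
  qed
  have "a mod 5 = 1"
  proof (rule ccontr)
    assume "a mod 5 \<noteq> 1"
    moreover have "a mod 5 < 5" "b mod 5 < 5" by simp_all
    ultimately have A: "a mod 5 \<in> {0,2,3,4}" and B: "b mod 5 \<in> {0,1,2,3,4}" by fastforce+
    have "\<forall>c\<in>{0,2,3,4::nat}. \<forall>d\<in>{0,1,2,3,4::nat}. \<exists>x\<in>{1,2,3,4,5::nat}. (c * x + d) mod 5 = x mod 5"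
      by simp
    from bspec[OF bspec[OF this A] B] have "\<exists>x\<in>{1,2,3,4,5}. (a mod 5 * x + b mod 5) mod 5 = x mod 5" .
    then obtain x where x: "x \<in> {1,2,3,4,5}" "(a mod 5 * x + b mod 5) mod 5 = x mod 5"
      by blast
    moreover have "(a mod 5 * x + b mod 5) mod 5 = (a * x + b) mod 5"
      by (intro mod_add_cong mod_mult_cong) simp_all
    moreover have "x \<in> {1..5}" using x(1) by auto
    ultimately have "p x mod 5 = x mod 5" using ab[of x] by simp
    then show False using eq[OF _ range, of x x] no_fix[of x] x(1) by auto
  qed
  then have shift: "p x mod 5 = (x mod 5 + b) mod 5" if "x \<in> {1..5}" for x
    using ab[OF that] by (metis mod_add_left_eq mod_mult_left_eq mult_1)
  have "p \<circ> p \<circ> p \<circ> p \<circ> p = transpose 6 7"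
  proof
    fix x :: nat
    consider "x \<in> {1..5}" | "x = 6" | "x = 7" | "x \<notin> {1..7}" by fastforce
    then show "(p \<circ> p \<circ> p \<circ> p \<circ> p) x = transpose 6 7 x"
    proof cases
      case 1
      have "p (p (p (p (p x)))) mod 5 = (x + b + b + b + b + b) mod 5"
        by (simp only: shift range 1 mod_add_left_eq)
      also have "\<dots> = x mod 5" by presburger
      finally have "p (p (p (p (p x)))) = x" by (rule eq) (intro range 1)+
      then show ?thesis using 1 by auto
    qed (use p67 permutes_not_in[OF p] in auto)
  qed
  then have "\<not> evenperm (p \<circ> p \<circ> p \<circ> p \<circ> p)" by (simp add: evenperm_swap)
  then show "\<not> evenperm p"
    using p by (simp add: evenperm_comp_permutes[of "{1..7}"] permutes_compose del: o_apply)
next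
  fix p q :: "nat \<Rightarrow> nat"
  assume q_perm: "q permutes {1..7}"
    and p: "p ` {6,7} = {6,7} \<and> affine_mod5 p"
    and q: "q ` {6,7} = {6,7} \<and> affine_mod5 q"
  obtain a b c d where ab: "\<And>x. x \<in> {1..5} \<Longrightarrow> p x mod 5 = (a * x + b) mod 5"
    and cd: "\<And>x. x \<in> {1..5} \<Longrightarrow> q x mod 5 = (c * x + d) mod 5"
    using p q unfolding affine_mod5_def by blast
  have q_range: "q x \<in> {1..5}" if "x \<in> {1..5}" for x
  proof -
    have "q x \<notin> q ` {6,7}"
      unfolding inj_image_mem_iff[OF permutes_inj[OF q_perm]] using that by simp
    then have "q x \<notin> {6,7}" by (simp only: conjunct1[OF q] not_False_eq_True)
    moreover have "q x \<in> {1..7}" using permutes_in_image[OF q_perm, of x] that by auto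
    ultimately show ?thesis by force
  qed
  have "(p \<circ> q) x mod 5 = ((a * c) * x + (a * d + b)) mod 5" if "x \<in> {1..5}" for x
  proof -
    have "(p \<circ> q) x mod 5 = (a * q x + b) mod 5"
      using ab[OF q_range[OF that]] by simp
    also have "\<dots> = (a * (c * x + d) + b) mod 5"
      using cd[OF that] by (intro mod_add_cong mod_mult_cong) simp_all
    finally show ?thesis by (simp add: algebra_simps)
  qed
  then show "(p \<circ> q) ` {6,7} = {6,7} \<and> affine_mod5 (p \<circ> q)"
  proof (intro conjI)
    show "(p \<circ> q) ` {6,7} = {6,7}" using p q by (simp only: image_comp [symmetric])
  qed (unfold affine_mod5_def, blast)
next
  fix x :: nat assume x: "x \<in> {1..7}"
  have five: "{1..5::nat} = {1,2,3,4,5}" by auto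
  show "\<exists>p. p permutes {1..7} \<and> evenperm p \<and>
    (p ` {6,7} = {6,7} \<and> affine_mod5 p) \<and> p x \<noteq> x"
  proof (cases "x \<le> 5")
    case True
    \<comment> \<open>the 5-cycle \<open>x \<mapsto> x + 1\<close>\<close>
    let ?c = "transpose 1 2 \<circ> transpose 2 3 \<circ> transpose 3 4 \<circ> transpose 4 5 :: nat \<Rightarrow> nat"
    have "\<forall>x\<in>{1..5}. ?c x mod 5 = (1 * x + 1) mod 5"
      unfolding five by (simp add: transpose_def)
    then have "affine_mod5 ?c" unfolding affine_mod5_def by blast
    moreover have "?c x \<noteq> x" using x True by (auto simp: transpose_def)
    moreover have "?c ` {6,7} = {6,7}" by simp
    moreover have "evenperm ?c"
      by (simp add: evenperm_comp evenperm_swap permutation_swap_id permutation_compose del: o_apply)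
    moreover have "?c permutes {1..7}" by (intro permutes_compose permutes_swap_id) auto
    ultimately show ?thesis by blast
  next
    case False
    \<comment> \<open>the 4-cycle \<open>x \<mapsto> 2 * x\<close>, made even by swapping 6 and 7\<close>
    let ?m = "transpose 1 2 \<circ> transpose 2 4 \<circ> transpose 3 4 \<circ> transpose 6 7 :: nat \<Rightarrow> nat"
    have "\<forall>x\<in>{1..5}. ?m x mod 5 = (2 * x + 0) mod 5"
      unfolding five by (simp add: transpose_def)
    then have "affine_mod5 ?m" unfolding affine_mod5_def by blast
    moreover have "?m x \<noteq> x" using x False by (auto simp: transpose_def)
    moreover have "?m ` {6,7} = {6,7}" by (auto simp: transpose_def)
    moreover have "evenperm ?m"
      by (simp add: evenperm_comp evenperm_swap permutation_swap_id permutation_compose del: o_apply)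
    moreover have "?m permutes {1..7}" by (intro permutes_compose permutes_swap_id) auto
    ultimately show ?thesis by blast
  qed
next
  show "id ` {6,7} = {6,7::nat} \<and> affine_mod5 id"
    unfolding affine_mod5_def by (intro conjI exI[of _ 1] exI[of _ 0]) auto
qed

section \<open>The classification\<close>

lemma not_fixating_alt_group:
  assumes "n \<ge> 5"
  shows "\<not> fixating {1..n} (alt_group n)"
proof -
  consider "n = 5" | "n = 6" | "n = 7" | "5 + 3 \<le> n" using assms by linarith
  then show ?thesis
    using not_fixating_alt_group_5 not_fixating_alt_group_6 not_fixating_alt_group_7
      not_fixating_alt_group_extend[OF not_fixating_alt_group_5] by cases auto
qed

lemma alt_group_eq: "alt_group n = (sym_group n)\<lparr>carrier := carrier (alt_group n)\<rparr>"
  by (simp add: alt_group_def)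

theorem theorem6p1:
  fixes n :: nat
  assumes "n \<ge> 1"
  shows "(fixating {1..n} (sym_group n) \<longleftrightarrow> n \<le> 4) \<and>
         (fixating {1..n} (alt_group n) \<longleftrightarrow> n \<le> 4)"
proof -
  have "fixating {1..n} (alt_group n)" if "fixating {1..n} (sym_group n)"
    using fixating_subgroup[OF sym_group_is_group alt_group_is_subgroup that]
    by (simp flip: alt_group_eq)
  moreover have "\<not> fixating {1..n} (alt_group n)" if "\<not> n \<le> 4"
    using not_fixating_alt_group[of n] that by simp
  ultimately show ?thesis using fixating_sym_group[of n] by blast
qed

end
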